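(* Let $N\geq 2$ be an integer. The number of matrices $T(\alpha_1,\dots,\alpha_n)$, of arbitrary finite size $n\geq 1$, with integral diagonal entries $\alpha_1,\dots,\alpha_n\geq 2$ and with determinant $N$ is equal to Euler's totient function $$\Phi(N)=N\prod_{p\mid N}\left(1-\frac1p\right)$$ (product over all prime divisors $p$ of $N$), which counts the number of invertible elements of the ring $\mathbb Z/N\mathbb Z$.
   Context: For a finite sequence $\alpha_1,\dots,\alpha_n$, $T(\alpha_1,\dots,\alpha_n)$ denotes the symmetric tridiagonal $n\times n$ matrix with diagonal entries $\alpha_1,\dots,\alpha_n$ (in this order), with all entries on the sub- and superdiagonal equal to $1$, and with all other entries equal to $0$. *)

theory Defs
  imports
    "Jordan_Normal_Form.Determinant"
    "HOL-Number_Theory.Number_Theory"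
begin

text \<open>The index \<open>i\<close> is zero-based, so \<open>as ! i\<close> is the \<open>(i + 1)\<close>-st diagonal entry.\<close>

definition tridiag_mat :: "'a :: {zero,one} list \<Rightarrow> 'a mat" where
  "tridiag_mat as = mat (length as) (length as)
     (\<lambda>(i, j). if i = j then as ! i else if i = Suc j \<or> j = Suc i then 1 else 0)"

definition tridiag_mats_with_det :: "int \<Rightarrow> int mat set" where
  "tridiag_mats_with_det d =
     {A. \<exists>as. length as \<ge> 1 \<and> (\<forall>a\<in>set as. a \<ge> 2) \<and> A = tridiag_mat as \<and> det A = d}"

end

theory Submission
  imports Defs
begin

text \<open>
  Expanding along the first column shows that the determinants
  \<open>d\<^sub>i = det (tridiag_mat (drop i as))\<close> of the lower right corners satisfy
  \<open>d\<^sub>i = \<alpha>\<^sub>i * d\<^sub>i\<^sub>+\<^sub>1 - d\<^sub>i\<^sub>+\<^sub>2\<close>, where \<open>0\<close> follows the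
  determinant \<open>1\<close> of the empty matrix. Read as \<open>d\<^sub>i\<^sub>+\<^sub>2 = \<alpha>\<^sub>i * d\<^sub>i\<^sub>+\<^sub>1 - d\<^sub>i\<close>,
  this is one step of the Euclidean algorithm in which the quotient is rounded up, and the
  condition \<open>\<alpha>\<^sub>i \<ge> 2\<close> says that such a step is being applied to a pair
  whose first entry exceeds the second one. So recording the determinant \<open>N\<close> of a
  matrix together with the determinant \<open>r\<close> of the matrix with its first row and column
  removed identifies diagonals with entries at least \<open>2\<close> with coprime pairs
  \<open>0 \<le> r < N\<close>: the rounded-up Euclidean algorithm started on \<open>(N, r)\<close> reads the diagonal
  back from the pair (\<open>neg_cf_inj\<close>, \<open>neg_cf_surj\<close>), which amounts to the expansion of
  \<open>N / r\<close> into a continued fraction with minus signs. For \<open>N \<ge> 2\<close> the admissible \<open>r\<close> are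
  exactly the residues counted by Euler's totient function.
\<close>

text \<open>
  The recursion carries two consecutive continuants at once. The pair \<open>(1, 0)\<close> for the empty
  list extends the determinant of the empty matrix by one further step
  of the recurrence, and it is the pair on which the Euclidean algorithm stops.
\<close>
fun neg_cf :: "'a :: comm_ring_1 list \<Rightarrow> 'a \<times> 'a" where
  "neg_cf [] = (1, 0)"
| "neg_cf (a # as) = (a * fst (neg_cf as) - snd (neg_cf as), fst (neg_cf as))"

lemma tridiag_mat_carrier: "tridiag_mat as \<in> carrier_mat (length as) (length as)"
  by (simp add: tridiag_mat_def)

lemma tridiag_mat_eq_iff: "tridiag_mat as = tridiag_mat bs \<longleftrightarrow> as = bs"
proof
  assume eq: "tridiag_mat as = tridiag_mat bs"
  have len: "length as = length bs"
    using arg_cong[OF eq, of dim_row] by (simp add: tridiag_mat_def)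
  have "as ! i = bs ! i" if "i < length as" for i
    using arg_cong[OF eq, of "\<lambda>A. A $$ (i, i)"] that len by (simp add: tridiag_mat_def)
  with len show "as = bs"
    by (intro nth_equalityI) auto
qed simp

lemma mat_delete_tridiag_mat: "mat_delete (tridiag_mat (a # as)) 0 0 = tridiag_mat as"
  by (rule eq_matI) (auto simp: tridiag_mat_def mat_delete_def)

text \<open>
  Without its second row and first column the matrix has first row \<open>(1, 0, \<dots>, 0)\<close>.
  Expanding along that row leaves the tridiagonal matrix with two entries dropped.
\<close>
lemma det_mat_delete_tridiag_mat:
  fixes as :: "'a :: comm_ring_1 list"
  shows "det (mat_delete (tridiag_mat (a # b # as)) 1 0) = det (tridiag_mat as)"
proof -
  define B where "B = mat_delete (tridiag_mat (a # b # as)) 1 0"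
  have B: "B \<in> carrier_mat (Suc (length as)) (Suc (length as))"
    by (simp add: B_def mat_delete_def tridiag_mat_def)
  have row: "B $$ (0, j) = (if j = 0 then 1 else 0)" if "j < Suc (length as)" for j
    using that by (auto simp: B_def mat_delete_def tridiag_mat_def)
  have minor: "mat_delete B 0 0 = tridiag_mat as"
    by (rule eq_matI) (auto simp: B_def tridiag_mat_def mat_delete_def)
  have "det B = (\<Sum>j<Suc (length as). B $$ (0, j) * cofactor B 0 j)"
    by (rule laplace_expansion_row[OF B]) simp
  also have "\<dots> = (\<Sum>j<Suc (length as). if j = 0 then cofactor B 0 0 else 0)"
    by (rule sum.cong) (auto simp: row)
  also have "\<dots> = det (tridiag_mat as)"
    by (simp add: cofactor_def minor)
  finally show ?thesis
    by (simp add: B_def)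
qed

lemma det_tridiag_mat_Cons_Cons:
  fixes as :: "'a :: comm_ring_1 list"
  shows "det (tridiag_mat (a # b # as)) =
    a * det (tridiag_mat (b # as)) - det (tridiag_mat as)"
proof -
  let ?A = "tridiag_mat (a # b # as)"
  let ?n = "Suc (Suc (length as))"
  have A: "?A \<in> carrier_mat ?n ?n"
    using tridiag_mat_carrier[of "a # b # as"] by simp
  have col: "?A $$ (i, 0) = (if i = 0 then a else if i = 1 then 1 else 0)" if "i < ?n" for i
    using that by (auto simp: tridiag_mat_def)
  have "det ?A = (\<Sum>i<?n. ?A $$ (i, 0) * cofactor ?A i 0)"
    by (rule laplace_expansion_column[OF A]) simp
  also have "\<dots> = (\<Sum>i\<in>{0, 1}. ?A $$ (i, 0) * cofactor ?A i 0)"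
    by (rule sum.mono_neutral_right) (auto simp: col)
  also have "\<dots> = a * cofactor ?A 0 0 + cofactor ?A 1 0"
    by (simp add: col)
  also have "\<dots> = a * det (tridiag_mat (b # as)) - det (tridiag_mat as)"
    unfolding cofactor_def mat_delete_tridiag_mat det_mat_delete_tridiag_mat by simp
  finally show ?thesis .
qed

lemma det_tridiag_mat:
  fixes as :: "'a :: comm_ring_1 list"
  shows "det (tridiag_mat as) = fst (neg_cf as)"
proof (induction as rule: induct_list012)
  case 1
  show ?case by (simp add: tridiag_mat_def)
next
  case (2 a)
  show ?case by (simp add: tridiag_mat_def det_single)
next
  case (3 a b as)
  then show ?case by (simp add: det_tridiag_mat_Cons_Cons)
qed

text \<open>
  The bound is preserved because \<open>a * p - r \<ge> 2 * p - r > p\<close> whenever \<open>r < p\<close>, and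
  coprimality because the step \<open>(p, r) \<mapsto> (a * p - r, p)\<close> is unimodular.
\<close>
lemma neg_cf_range:
  fixes as :: "int list"
  assumes "\<forall>a\<in>set as. a \<ge> 2"
  shows "0 \<le> snd (neg_cf as) \<and> snd (neg_cf as) < fst (neg_cf as)
    \<and> coprime (fst (neg_cf as)) (snd (neg_cf as))"
  using assms
proof (induction as)
  case (Cons a as)
  obtain p r where pr: "neg_cf as = (p, r)" by fastforce
  have IH: "0 \<le> r" "r < p" "coprime p r" and a: "a \<ge> 2"
    using Cons pr by auto
  have "2 * p \<le> a * p"
    using a IH by (intro mult_right_mono) auto
  then have "p < a * p - r"
    using IH by linarith
  moreover have "coprime (a * p - r) p"
  proof (rule coprimeI)
    fix c assume c: "c dvd a * p - r" "c dvd p"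
    then have "c dvd a * p - (a * p - r)"
      by (blast intro: dvd_diff dvd_mult)
    then have "c dvd r"
      by simp
    with IH(3) c(2) show "is_unit c"
      by (rule coprime_common_divisor)
  qed
  ultimately show ?case
    using IH pr by simp
qed simp

text \<open>
  The first entry of the list is the quotient, rounded up, of the two numbers in the pair:
  two solutions of \<open>p' = a * p - r\<close> with \<open>0 \<le> r < p\<close> have remainders \<open>r\<close> congruent modulo \<open>p\<close>.
\<close>
lemma neg_cf_inj:
  fixes as bs :: "int list"
  assumes "\<forall>a\<in>set as. a \<ge> 2" "\<forall>b\<in>set bs. b \<ge> 2" "neg_cf as = neg_cf bs"
  shows "as = bs"
  using assms
proof (induction as arbitrary: bs)
  case Nil
  show ?case
  proof (cases bs)
    case (Cons b bs')
    then show ?thesis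
      using Nil neg_cf_range[of bs'] by auto
  qed simp
next
  case (Cons a as)
  show ?case
  proof (cases bs)
    case Nil
    then show ?thesis
      using Cons.prems neg_cf_range[of as] by auto
  next
    case bs: (Cons b bs')
    define p where "p = fst (neg_cf as)"
    have p': "fst (neg_cf bs') = p"
      using Cons.prems bs by (simp add: p_def)
    have step: "a * p - snd (neg_cf as) = b * p - snd (neg_cf bs')"
      using Cons.prems bs p' by (simp add: p_def)
    have r: "0 \<le> snd (neg_cf as)" "snd (neg_cf as) < p"
      using neg_cf_range[of as] Cons.prems by (auto simp: p_def)
    have r': "0 \<le> snd (neg_cf bs')" "snd (neg_cf bs') < p"
      using neg_cf_range[of bs'] Cons.prems bs p' by auto
    have "snd (neg_cf as) = (a * p - (b * p - snd (neg_cf bs'))) mod p"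
      using step r by simp
    also have "\<dots> = (snd (neg_cf bs') + (a - b) * p) mod p"
      by (simp add: algebra_simps)
    also have "\<dots> = snd (neg_cf bs')"
      using r' by simp
    finally have snd_eq: "snd (neg_cf as) = snd (neg_cf bs')" .
    with step r have "a = b"
      by simp
    moreover have "as = bs'"
    proof (rule Cons.IH)
      show "neg_cf as = neg_cf bs'"
        using p' snd_eq unfolding p_def by (intro prod_eqI) (rule sym)
    qed (use Cons.prems bs in simp_all)
    ultimately show ?thesis
      using bs by simp
  qed
qed

text \<open>
  This is the Euclidean algorithm with quotients rounded up: it terminates because the second
  entry decreases, and a quotient is at least \<open>2\<close> because it is larger than \<open>1\<close> before rounding.
\<close>
lemma neg_cf_surj:
  fixes p r :: int
  assumes "0 \<le> r" "r < p" "coprime p r"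
  shows "\<exists>as. (\<forall>a\<in>set as. a \<ge> 2) \<and> neg_cf as = (p, r)"
  using assms
proof (induction "nat r" arbitrary: p r rule: less_induct)
  case less
  show ?case
  proof (cases "r = 0")
    case True
    with less.prems have "neg_cf [] = (p, r)"
      by simp
    then show ?thesis
      by (intro exI[of _ "[]"]) simp
  next
    case False
    with less.prems have r: "r > 0"
      by simp
    \<comment> \<open>\<open>a\<close> is the ceiling of \<open>p / r\<close>, and \<open>s\<close> measures how far \<open>a * r\<close> overshoots \<open>p\<close>.\<close>
    define a where "a = - ((- p) div r)"
    define s where "s = (- p) mod r"
    have s: "0 \<le> s" "s < r"
      using r by (simp_all add: s_def)
    have p: "p = a * r - s"
      using div_mult_mod_eq[of "- p" r] unfolding a_def s_def by linarith
    have "1 * r < a * r"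
      using p s less.prems by linarith
    then have a: "a \<ge> 2"
      using r by (simp only: mult_less_cancel_right) linarith
    have "coprime r s"
    proof (rule coprimeI)
      fix c assume c: "c dvd r" "c dvd s"
      then have "c dvd p"
        unfolding p by (intro dvd_diff dvd_mult)
      with less.prems(3) show "is_unit c"
        using c(1) by (rule coprime_common_divisor)
    qed
    then obtain as where "\<forall>a\<in>set as. a \<ge> 2" "neg_cf as = (r, s)"
      using less.hyps[of s r] s r by auto
    with a p show ?thesis
      by (intro exI[of _ "a # as"]) simp
  qed
qed

text \<open>
  The remainders range over \<open>{0..<N}\<close>, whereas totatives are taken from \<open>{1..N}\<close>. For \<open>N \<ge> 2\<close>
  this makes no difference, as neither \<open>0\<close> nor \<open>N\<close> is then coprime to \<open>N\<close>.
\<close>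
lemma bij_betw_snd_neg_cf_totatives:
  fixes N :: nat
  assumes "N \<ge> 2"
  shows "bij_betw (\<lambda>as. nat (snd (neg_cf as)))
    {as :: int list. (\<forall>a\<in>set as. a \<ge> 2) \<and> fst (neg_cf as) = int N} (totatives N)"
    (is "bij_betw ?f ?S _")
proof (rule bij_betw_imageI)
  show "inj_on ?f ?S"
  proof (rule inj_onI)
    fix as bs assume as: "as \<in> ?S" and bs: "bs \<in> ?S" and eq: "?f as = ?f bs"
    have "snd (neg_cf as) = snd (neg_cf bs)"
      using eq as bs neg_cf_range[of as] neg_cf_range[of bs] by auto
    with as bs show "as = bs"
      by (intro neg_cf_inj) (auto simp: prod_eq_iff)
  qed
  show "?f ` ?S = totatives N"
  proof (intro equalityI subsetI)
    fix k assume "k \<in> ?f ` ?S"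
    then obtain as where as: "as \<in> ?S" and k: "k = ?f as"
      by blast
    then have "int k < int N" and cop: "coprime (int N) (int k)"
      using neg_cf_range[of as] by auto
    moreover have "k \<noteq> 0"
      using cop assms by (cases "k = 0") auto
    ultimately show "k \<in> totatives N"
      by (auto simp: totatives_def coprime_commute)
  next
    fix k assume k: "k \<in> totatives N"
    then have "k < N"
      using totatives_less[of k N] assms by simp
    with k have "0 \<le> int k" "int k < int N" "coprime (int N) (int k)"
      by (auto simp: totatives_def coprime_commute)
    then obtain as where "\<forall>a\<in>set as. a \<ge> 2" "neg_cf as = (int N, int k)"
      using neg_cf_surj by blast
    then show "k \<in> ?f ` ?S"
      by (intro image_eqI[of _ _ as]) auto
  qed
qed

text \<open>
  The empty matrix has determinant \<open>1\<close>, so for every other determinant the requirement that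
  the matrix be nonempty is automatic.
\<close>
lemma tridiag_mats_with_det_eq_image:
  assumes "d \<noteq> 1"
  shows "tridiag_mats_with_det d = tridiag_mat ` {as. (\<forall>a\<in>set as. a \<ge> 2) \<and> fst (neg_cf as) = d}"
proof -
  have "length as \<ge> 1" if "fst (neg_cf as) = d" for as :: "int list"
    using that assms by (cases as) auto
  then show ?thesis
    unfolding tridiag_mats_with_det_def by (fastforce simp: det_tridiag_mat)
qed

theorem theorem1p1:
  fixes N :: nat
  assumes "N \<ge> 2"
  shows "finite (tridiag_mats_with_det (int N))
       \<and> card (tridiag_mats_with_det (int N)) = totient N
       \<and> real (totient N) = real N * (\<Prod>p | prime p \<and> p dvd N. 1 - 1 / real p)
       \<and> totient N = card (Units (residue_ring (int N)))"
proof (intro conjI)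
  let ?S = "{as :: int list. (\<forall>a\<in>set as. a \<ge> 2) \<and> fst (neg_cf as) = int N}"
  have image: "tridiag_mats_with_det (int N) = tridiag_mat ` ?S"
    using assms by (intro tridiag_mats_with_det_eq_image) auto
  have inj: "inj_on tridiag_mat ?S"
    by (rule inj_onI) (simp add: tridiag_mat_eq_iff)
  have bij: "bij_betw (\<lambda>as. nat (snd (neg_cf as))) ?S (totatives N)"
    using assms by (rule bij_betw_snd_neg_cf_totatives)
  show "finite (tridiag_mats_with_det (int N))"
    unfolding image using bij_betw_finite[OF bij] by simp
  show "card (tridiag_mats_with_det (int N)) = totient N"
    unfolding image using bij_betw_same_card[OF bij] by (simp add: card_image[OF inj] totient_def)
  have "{p. prime p \<and> p dvd N} = prime_factors N"
    using assms by (auto simp: prime_factors_dvd)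
  then show "real (totient N) = real N * (\<Prod>p | prime p \<and> p dvd N. 1 - 1 / real p)"
    using totient_formula2[of N] by simp
  show "totient N = card (Units (residue_ring (int N)))"
    using residues.totient_eq[of "int N"] assms by (simp add: residues_def)
qed

end
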